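(* Let $\mathfrak{g}$ be a finite-dimensional non-abelian Leibniz algebra over $\mathbb{K}$ satisfying $\gamma_2^{\mathrm{Lie}}(\mathfrak{g})\subseteq Z(\mathfrak{g})$. Then $\mathrm{Der}_c^{\mathrm{Lie}}(\mathfrak{g})=\mathrm{Der}_z^{\mathrm{Lie}}(\mathfrak{g})$ if and only if both $Z^{\mathrm{Lie}}(\mathfrak{g})=\gamma_2^{\mathrm{Lie}}(\mathfrak{g})$ and $\mathrm{Der}_c^{\mathrm{Lie}}(\mathfrak{g})\cong T\left(\frac{\mathfrak{g}}{Z^{\mathrm{Lie}}(\mathfrak{g})},\gamma_2^{\mathrm{Lie}}(\mathfrak{g})\right)$ (as $\mathbb K$-vector spaces).
   Context: $\mathbb{K}$ is a field with $\frac12\in\mathbb{K}$; vector spaces are over $\mathbb{K}$. A Leibniz algebra is a vector space $\mathfrak{g}$ with a bilinear map $[-,-]:\mathfrak{g}\times\mathfrak{g}\to\mathfrak{g}$ satisfying $[x,[y,z]]=[[x,y],z]-[[x,z],y]$ for all $x,y,z\in\mathfrak g$; it is non-abelian if its bracket is not identically zero. Put $[x,y]_{\mathrm{Lie}}=[x,y]+[y,x]$. $\gamma_2^{\mathrm{Lie}}(\mathfrak{g})=[\mathfrak g,\mathfrak g]_{\mathrm{Lie}}$ is the two-sided ideal of $\mathfrak g$ generated by all $[x,y]_{\mathrm{Lie}}$, $x,y\in\mathfrak{g}$. The centre is $Z(\mathfrak{g})=\{z\in\mathfrak{g}\mid [x,z]=[z,x]=0\text{ for all }x\in\mathfrak{g}\}$.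 The Lie-centre is $Z^{\mathrm{Lie}}(\mathfrak{g})=\{z\in\mathfrak{g}\mid [x,z]_{\mathrm{Lie}}=0\text{ for all }x\in\mathfrak{g}\}$. A Lie-derivation is a linear map $d:\mathfrak{g}\to\mathfrak{g}$ with $d([x,y]_{\mathrm{Lie}})=[d(x),y]_{\mathrm{Lie}}+[x,d(y)]_{\mathrm{Lie}}$ for all $x,y\in\mathfrak g$. $\mathrm{Der}_z^{\mathrm{Lie}}(\mathfrak{g})$ is the set of Lie-derivations with image contained in $Z^{\mathrm{Lie}}(\mathfrak{g})$ (Lie-central derivations). $\mathrm{Der}_c^{\mathrm{Lie}}(\mathfrak{g})$ is the set of almost inner Lie-derivations, i.e. Lie-derivations $d$ such that $d(x)\in[x,\mathfrak{g}]_{\mathrm{Lie}}=\{[x,y]_{\mathrm{Lie}}\mid y\in\mathfrak g\}$ for all $x\in\mathfrak{g}$. For vector spaces $V,W$, $T(V,W)$ denotes the vector space of all $\mathbb{K}$-linear maps $V\to W$. *)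

theory Defs
  imports Complex_Main "HOL-Library.FuncSet"
begin

text \<open>The algebra is a whole type \<open>'g\<close>, a vector space over the field \<open>'k\<close> with scalar
  multiplication \<open>scale\<close>; \<open>br x y\<close> is the bracket of \<open>x\<close> and \<open>y\<close>.\<close>

locale leibniz_algebra = vector_space scale
  for scale :: "'k::field \<Rightarrow> 'g::ab_group_add \<Rightarrow> 'g" +
  fixes br :: "'g \<Rightarrow> 'g \<Rightarrow> 'g"
  assumes linear_right: "\<And>x. Vector_Spaces.linear scale scale (\<lambda>y. br x y)"
    and linear_left: "\<And>y. Vector_Spaces.linear scale scale (\<lambda>x. br x y)"
    and leibniz: "\<And>x y z. br x (br y z) = br (br x y) z - br (br x z) y"

definition non_abelian :: "('g \<Rightarrow> 'g \<Rightarrow> 'g::ab_group_add) \<Rightarrow> bool" where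
  "non_abelian br \<longleftrightarrow> (\<exists>x y. br x y \<noteq> 0)"

definition lie_br :: "('g \<Rightarrow> 'g \<Rightarrow> 'g::ab_group_add) \<Rightarrow> 'g \<Rightarrow> 'g \<Rightarrow> 'g" where
  "lie_br br x y = br x y + br y x"

definition two_sided_ideal ::
    "('k::field \<Rightarrow> 'g::ab_group_add \<Rightarrow> 'g) \<Rightarrow> ('g \<Rightarrow> 'g \<Rightarrow> 'g) \<Rightarrow> 'g set \<Rightarrow> bool" where
  "two_sided_ideal scale br I \<longleftrightarrow>
     module.subspace scale I \<and> (\<forall>x. \<forall>i\<in>I. br x i \<in> I \<and> br i x \<in> I)"

definition gamma2_Lie ::
    "('k::field \<Rightarrow> 'g::ab_group_add \<Rightarrow> 'g) \<Rightarrow> ('g \<Rightarrow> 'g \<Rightarrow> 'g) \<Rightarrow> 'g set" where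
  "gamma2_Lie scale br =
     \<Inter>{I. two_sided_ideal scale br I \<and> {lie_br br x y |x y. True} \<subseteq> I}"

definition centre :: "('g \<Rightarrow> 'g \<Rightarrow> 'g::ab_group_add) \<Rightarrow> 'g set" where
  "centre br = {z. \<forall>x. br x z = 0 \<and> br z x = 0}"

definition Lie_centre :: "('g \<Rightarrow> 'g \<Rightarrow> 'g::ab_group_add) \<Rightarrow> 'g set" where
  "Lie_centre br = {z. \<forall>x. lie_br br x z = 0}"

definition Lie_derivation ::
    "('k::field \<Rightarrow> 'g::ab_group_add \<Rightarrow> 'g) \<Rightarrow> ('g \<Rightarrow> 'g \<Rightarrow> 'g) \<Rightarrow> ('g \<Rightarrow> 'g) \<Rightarrow> bool" where
  "Lie_derivation scale br d \<longleftrightarrow>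
     Vector_Spaces.linear scale scale d \<and>
     (\<forall>x y. d (lie_br br x y) = lie_br br (d x) y + lie_br br x (d y))"

definition Der_z_Lie ::
    "('k::field \<Rightarrow> 'g::ab_group_add \<Rightarrow> 'g) \<Rightarrow> ('g \<Rightarrow> 'g \<Rightarrow> 'g) \<Rightarrow> ('g \<Rightarrow> 'g) set" where
  "Der_z_Lie scale br = {d. Lie_derivation scale br d \<and> range d \<subseteq> Lie_centre br}"

definition Der_c_Lie ::
    "('k::field \<Rightarrow> 'g::ab_group_add \<Rightarrow> 'g) \<Rightarrow> ('g \<Rightarrow> 'g \<Rightarrow> 'g) \<Rightarrow> ('g \<Rightarrow> 'g) set" where
  "Der_c_Lie scale br =
     {d. Lie_derivation scale br d \<and> (\<forall>x. d x \<in> {lie_br br x y |y. True})}"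


text \<open>Quotients and spaces of linear maps do not live on whole types, so vector spaces are
  given here by a carrier with its operations. The zero vector is determined by these.\<close>

record ('k, 'v) vspace =
  vcarrier :: "'v set"
  vadd :: "'v \<Rightarrow> 'v \<Rightarrow> 'v"
  vscale :: "'k \<Rightarrow> 'v \<Rightarrow> 'v"

definition vlinear :: "('k, 'v) vspace \<Rightarrow> ('k, 'w) vspace \<Rightarrow> ('v \<Rightarrow> 'w) \<Rightarrow> bool" where
  "vlinear V W f \<longleftrightarrow>
     f \<in> vcarrier V \<rightarrow> vcarrier W \<and>
     (\<forall>x\<in>vcarrier V. \<forall>y\<in>vcarrier V. f (vadd V x y) = vadd W (f x) (f y)) \<and>
     (\<forall>c. \<forall>x\<in>vcarrier V. f (vscale V c x) = vscale W c (f x))"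

definition visomorphic :: "('k, 'v) vspace \<Rightarrow> ('k, 'w) vspace \<Rightarrow> bool" where
  "visomorphic V W \<longleftrightarrow> (\<exists>f. vlinear V W f \<and> bij_betw f (vcarrier V) (vcarrier W))"

definition subspace_of ::
    "('k::field \<Rightarrow> 'g::ab_group_add \<Rightarrow> 'g) \<Rightarrow> 'g set \<Rightarrow> ('k, 'g) vspace" where
  "subspace_of scale U = \<lparr>vcarrier = U, vadd = (+), vscale = scale\<rparr>"

definition coset :: "'g set \<Rightarrow> 'g::ab_group_add \<Rightarrow> 'g set" where
  "coset U x = {x + u |u. u \<in> U}"

text \<open>The summand \<open>u\<close> in the scalar multiplication matters for the scalar 0: the product has to
  be the coset \<open>U\<close>, not \<open>{0}\<close>.\<close>

definition quotient_space ::
    "('k::field \<Rightarrow> 'g::ab_group_add \<Rightarrow> 'g) \<Rightarrow> 'g set \<Rightarrow> ('k, 'g set) vspace" where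
  "quotient_space scale U =
     \<lparr>vcarrier = range (coset U),
      vadd = (\<lambda>A B. {a + b |a b. a \<in> A \<and> b \<in> B}),
      vscale = (\<lambda>c A. {scale c a + u |a u. a \<in> A \<and> u \<in> U})\<rparr>"

text \<open>The space \<open>T(V, W)\<close>. Maps are taken to be \<open>undefined\<close> outside the carrier of \<open>V\<close>, so that
  maps agreeing on \<open>V\<close> are equal.\<close>

definition linear_maps :: "('k, 'v) vspace \<Rightarrow> ('k, 'w) vspace \<Rightarrow> ('k, 'v \<Rightarrow> 'w) vspace" where
  "linear_maps V W =
     \<lparr>vcarrier = {f \<in> extensional (vcarrier V). vlinear V W f},
      vadd = (\<lambda>f g. \<lambda>x\<in>vcarrier V. vadd W (f x) (g x)),
      vscale = (\<lambda>c f. \<lambda>x\<in>vcarrier V. vscale W c (f x))\<rparr>"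

definition map_space ::
    "('k::field \<Rightarrow> 'g::ab_group_add \<Rightarrow> 'g) \<Rightarrow> ('g \<Rightarrow> 'g) set \<Rightarrow> ('k, 'g \<Rightarrow> 'g) vspace" where
  "map_space scale D =
     \<lparr>vcarrier = D, vadd = (\<lambda>d e x. d x + e x), vscale = (\<lambda>c d x. scale c (d x))\<rparr>"

lemma (in vector_space) quotient_space_vadd:
  assumes "subspace U"
  shows "vadd (quotient_space scale U) (coset U x) (coset U y) = coset U (x + y)"
proof -
  have "{a + b |a b. a \<in> coset U x \<and> b \<in> coset U y} = coset U (x + y)" (is "?L = ?R")
  proof
    show "?L \<subseteq> ?R"
    proof
      fix z assume "z \<in> ?L"
      then obtain u v where uv: "z = (x + u) + (y + v)" "u \<in> U" "v \<in> U"
        unfolding coset_def by blast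
      then have "z = x + y + (u + v)" "u + v \<in> U"
        using assms by (simp_all add: subspace_add ac_simps)
      then show "z \<in> ?R"
        unfolding coset_def by blast
    qed
    show "?R \<subseteq> ?L"
    proof
      fix z assume "z \<in> ?R"
      then obtain u where u: "z = x + y + u" "u \<in> U"
        unfolding coset_def by blast
      then have "z = (x + u) + (y + 0)" "0 \<in> U"
        using assms by (simp_all add: subspace_0 ac_simps)
      then show "z \<in> ?L"
        using u(2) unfolding coset_def by blast
    qed
  qed
  then show ?thesis
    by (simp add: quotient_space_def)
qed

lemma (in vector_space) quotient_space_vscale:
  assumes "subspace U"
  shows "vscale (quotient_space scale U) c (coset U x) = coset U (scale c x)"
proof -
  have "{scale c a + u |a u. a \<in> coset U x \<and> u \<in> U} = coset U (scale c x)" (is "?L = ?R")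
  proof
    show "?L \<subseteq> ?R"
    proof
      fix z assume "z \<in> ?L"
      then obtain u v where uv: "z = scale c (x + u) + v" "u \<in> U" "v \<in> U"
        unfolding coset_def by blast
      then have "z = scale c x + (scale c u + v)" "scale c u + v \<in> U"
        using assms by (simp_all add: subspace_add subspace_scale scale_right_distrib add.assoc)
      then show "z \<in> ?R"
        unfolding coset_def by blast
    qed
    show "?R \<subseteq> ?L"
    proof
      fix z assume "z \<in> ?R"
      then obtain u where u: "z = scale c x + u" "u \<in> U"
        unfolding coset_def by blast
      then have "z = scale c (x + 0) + u" "0 \<in> U"
        using assms by (simp_all add: subspace_0)
      then show "z \<in> ?L"
        using u(2) unfolding coset_def by blast
    qed
  qed
  then show ?thesis
    by (simp add: quotient_space_def)
qed

end

theory Submission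
  imports Defs "HOL-Library.Function_Algebras"
begin

text \<open>Since \<open>\<gamma>\<^sub>2 \<subseteq> Z\<close>, a Lie-derivation with values in the Lie-centre \<open>Z\<^sup>L\<close> is the same thing as a
  linear map into \<open>Z\<^sup>L\<close> that vanishes on \<open>\<gamma>\<^sub>2\<close>, and every almost inner Lie-derivation is one.
  If \<open>Z\<^sup>L = \<gamma>\<^sub>2\<close>, the Lie-central derivations are therefore \<open>T(\<gg>/Z\<^sup>L, \<gamma>\<^sub>2)\<close>, and an isomorphism of
  the subspace of almost inner ones with this finite-dimensional space forces equality.
  Conversely, as \<open>\<gamma>\<^sub>2 \<noteq> \<gg>\<close>, an element \<open>z\<close> of \<open>Z\<^sup>L\<close> outside \<open>\<gamma>\<^sub>2\<close> gives a Lie-central derivation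
  \<open>x \<mapsto> f(x) z\<close>, \<open>f\<close> a nonzero functional vanishing on \<open>\<gamma>\<^sub>2\<close>, which is not almost inner because
  almost inner Lie-derivations take values in \<open>\<gamma>\<^sub>2\<close>.\<close>

section \<open>Linear maps between vector spaces\<close>

text \<open>Dimension count: \<open>k\<close> sends a basis \<open>B\<close> of \<open>D\<close> to
  an independent set of the same size in \<open>C\<close>. Adding some \<open>d\<close> in
  \<open>D\<close> outside \<open>C\<close> would keep it independent, giving
  \<open>card B + 1\<close> independent vectors in \<open>span B\<close>.\<close>

lemma (in vector_space) subspace_eq_if_injective:
  assumes C: "subspace C" and D: "subspace D" and "C \<subseteq> D"
    and F: "finite F" "D \<subseteq> span F"
    and add: "\<And>x y. x \<in> D \<Longrightarrow> y \<in> D \<Longrightarrow> k (x + y) = k x + k y"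
    and scl: "\<And>c x. x \<in> D \<Longrightarrow> k (scale c x) = scale c (k x)"
    and inj: "inj_on k D" and kC: "k ` D \<subseteq> C"
  shows "C = D"
proof (rule ccontr)
  assume "C \<noteq> D"
  then obtain d where d: "d \<in> D" "d \<notin> C"
    using \<open>C \<subseteq> D\<close> by blast
  obtain B where B: "B \<subseteq> D" "independent B" "D \<subseteq> span B"
    using maximal_independent_subset .
  have BD: "span B = D"
    using B span_minimal[OF B(1) D] by blast
  have finB: "finite B"
    using independent_span_bound[OF F(1) B(2)] B(1) F(2) by blast
  interpret P: vector_space_pair scale scale ..
  \<comment> \<open>\<open>k\<close> is linear only on \<open>D\<close>. Its linear extension
    \<open>K\<close> from \<open>B\<close> to the whole space agrees with it on
    \<open>D = span B\<close>, so facts about globally linear maps become available.\<close>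
  define K where "K = P.construct B k"
  have linK: "Vector_Spaces.linear scale scale K"
    unfolding K_def by (rule P.linear_construct[OF B(2)])
  have K0: "K 0 = 0" and Kadd: "K (x + y) = K x + K y" and Kscl: "K (scale c x) = scale c (K x)"
    for x y c
    using P.linear_0[OF linK] P.linear_add[OF linK] P.linear_scale[OF linK] by auto
  have k0: "k 0 = 0"
    using add[of 0 0] subspace_0[OF D] by simp
  have sub: "subspace {x \<in> D. K x = k x}"
    using D by (auto simp: subspace_def K0 k0 Kadd Kscl add scl)
  have "span B \<subseteq> {x \<in> D. K x = k x}"
    by (rule span_minimal[OF _ sub]) (use B(1) P.construct_basis[OF B(2)] in \<open>auto simp: K_def\<close>)
  then have Kk: "K x = k x" if "x \<in> D" for x
    using that BD by auto
  have "inj_on K (span B)"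
    using inj Kk by (simp add: BD inj_on_def)
  then have "independent (K ` B)"
    by (rule P.linear_independent_injective_image[OF linK B(2)])
  then have ind: "independent (k ` B)"
    using Kk B(1) by (simp add: subset_iff cong: image_cong_simp)
  have kB: "k ` B \<subseteq> C"
    using kC B(1) by blast
  have dnot: "d \<notin> span (k ` B)"
    using span_minimal[OF kB C] d by blast
  then have "independent (insert d (k ` B))"
    using independent_insertI ind by blast
  moreover have "insert d (k ` B) \<subseteq> span B"
    using d(1) kB \<open>C \<subseteq> D\<close> BD by blast
  ultimately have "card (insert d (k ` B)) \<le> card B"
    using independent_span_bound[OF finB] by blast
  moreover have "card (k ` B) = card B"
    using inj B(1) by (meson card_image inj_on_subset)
  moreover have "d \<notin> k ` B"
    using dnot span_base by blast
  ultimately show False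
    using finB by simp
qed

text \<open>This lets the dimension count be applied to spaces of maps, with the pointwise
  \<open>+\<close> and \<open>0\<close> of \<open>Function_Algebras\<close>.\<close>

lemma (in vector_space) vector_space_fun: "vector_space (\<lambda>c (f :: 'x \<Rightarrow> 'b) x. scale c (f x))"
  by unfold_locales (simp_all add: fun_eq_iff scale_right_distrib scale_left_distrib)

text \<open>The maps \<open>x \<mapsto> b\<^sup>*(x) b'\<close>, for \<open>b\<close>, \<open>b'\<close> in a basis, span the space of linear maps.\<close>

lemma (in finite_dimensional_vector_space) linear_maps_finite_span:
  obtains F where "finite F"
    "{d. Vector_Spaces.linear scale scale d} \<subseteq> module.span (\<lambda>c f x. scale c (f x)) F"
proof
  interpret fn: vector_space "\<lambda>c (f :: 'b \<Rightarrow> 'b) x. scale c (f x)"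
    by (rule vector_space_fun)
  interpret P: vector_space_pair scale scale ..
  let ?E = "\<lambda>(b, b') x. scale (representation Basis x b) b'"
  show "finite (?E ` (Basis \<times> Basis))"
    using finite_Basis by simp
  have rep: "(\<Sum>b\<in>Basis. scale (representation Basis v b) b) = v" for v
    by (rule sum_representation_eq) (simp_all add: independent_Basis span_Basis finite_Basis)
  show "{d. Vector_Spaces.linear scale scale d} \<subseteq> fn.span (?E ` (Basis \<times> Basis))"
  proof (intro subsetI, unfold mem_Collect_eq)
    fix d assume d: "Vector_Spaces.linear scale scale d"
    \<comment> \<open>The coefficient at \<open>(b, b')\<close> is the matrix entry of
      \<open>d\<close>, the \<open>b'\<close>-coordinate of \<open>d b\<close>.\<close>
    have eval: "d x = (\<Sum>p\<in>Basis \<times> Basis. scale (representation Basis (d (fst p)) (snd p)) (?E p x))" for x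
    proof -
      have "d x = d (\<Sum>b\<in>Basis. scale (representation Basis x b) b)"
        by (simp only: rep)
      also have "\<dots> = (\<Sum>b\<in>Basis. scale (representation Basis x b) (d b))"
        by (simp add: P.linear_sum[OF d] P.linear_scale[OF d])
      also have "\<dots> = (\<Sum>b\<in>Basis. scale (representation Basis x b)
                        (\<Sum>b'\<in>Basis. scale (representation Basis (d b) b') b'))"
        by (simp only: rep)
      also have "\<dots> = (\<Sum>b\<in>Basis. \<Sum>b'\<in>Basis. scale (representation Basis (d b) b')
                        (scale (representation Basis x b) b'))"
        by (simp add: scale_sum_right mult.commute)
      finally show ?thesis
        by (simp add: sum.cartesian_product case_prod_beta)
    qed
    \<comment> \<open>Turns the identity of values \<open>eval\<close> into an identity of maps, as
      membership in \<open>fn.span\<close> requires.\<close>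
    have sum_apply: "(\<Sum>p\<in>S. f p) x = (\<Sum>p\<in>S. f p x)" for f :: "'b \<times> 'b \<Rightarrow> 'b \<Rightarrow> 'b" and S x
      by (induction S rule: infinite_finite_induct) simp_all
    have "d = (\<Sum>p\<in>Basis \<times> Basis. (\<lambda>x. scale (representation Basis (d (fst p)) (snd p)) (?E p x)))"
      by (rule ext, rule trans[OF eval sum_apply[symmetric]])
    also have "\<dots> \<in> fn.span (?E ` (Basis \<times> Basis))"
      by (intro fn.span_sum fn.span_scale fn.span_base imageI)
    finally show "d \<in> fn.span (?E ` (Basis \<times> Basis))" .
  qed
qed

lemma (in vector_space) coset_eq_iff:
  assumes "subspace U"
  shows "coset U x = coset U y \<longleftrightarrow> x - y \<in> U"
proof
  assume "coset U x = coset U y"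
  moreover have "x \<in> coset U x"
    using subspace_0[OF assms] by (force simp: coset_def)
  ultimately show "x - y \<in> U"
    by (auto simp: coset_def)
next
  have sub: "coset U v \<subseteq> coset U w" if "v - w \<in> U" for v w
  proof
    fix z assume "z \<in> coset U v"
    then obtain u where u: "z = v + u" "u \<in> U"
      by (auto simp: coset_def)
    have "z = w + ((v - w) + u)"
      using u(1) by simp
    then show "z \<in> coset U w"
      using subspace_add[OF assms that u(2)] unfolding coset_def by blast
  qed
  assume "x - y \<in> U"
  then show "coset U x = coset U y"
    using sub[of x y] sub[of y x] subspace_neg[OF assms, of "x - y"] by auto
qed

text \<open>The universal property of the quotient: a linear map killing \<open>U\<close> descends
  to cosets, and composing with the projection inverts this.\<close>

lemma (in vector_space) map_space_iso_linear_maps: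
  assumes U: "subspace U"
  shows "visomorphic
    (map_space scale {d. Vector_Spaces.linear scale scale d \<and> (\<forall>u\<in>U. d u = 0) \<and> range d \<subseteq> W})
    (linear_maps (quotient_space scale U) (subspace_of scale W))"
    (is "visomorphic (map_space scale ?D) ?T")
proof -
  interpret P: vector_space_pair scale scale ..
  define rep where "rep A = (SOME x. coset U x = A)" for A
  have rep: "coset U (rep (coset U x)) = coset U x" for x
    unfolding rep_def by (rule someI) (rule refl)
  \<comment> \<open>Evaluation at a chosen representative; for \<open>d\<close> in \<open>?D\<close>
    the choice is irrelevant, since two representatives differ by an element of \<open>U\<close>.
    The restriction supplies the value \<open>undefined\<close> off the cosets that
    \<open>linear_maps\<close> demands.\<close>
  define r where "r d = (\<lambda>A\<in>range (coset U). d (rep A))" for d :: "'b \<Rightarrow> 'b"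
  have r_coset: "r d (coset U x) = d x" if "d \<in> ?D" for d x
  proof -
    have "d (rep (coset U x) - x) = 0"
      using that rep[of x] coset_eq_iff[OF U] by auto
    then show ?thesis
      using that P.linear_diff[of d] by (auto simp: r_def)
  qed
  have car: "vcarrier (quotient_space scale U) = range (coset U)"
    by (simp add: quotient_space_def)
  have r_T: "r d \<in> vcarrier ?T" if "d \<in> ?D" for d
  proof -
    have "vlinear (quotient_space scale U) (subspace_of scale W) (r d)"
      unfolding vlinear_def car
      using that P.linear_add[of d] P.linear_scale[of d]
      by (auto simp: quotient_space_vadd[OF U] quotient_space_vscale[OF U] r_coset[OF that]
          subspace_of_def)
    moreover have "r d \<in> extensional (range (coset U))"
      by (simp add: r_def)
    ultimately show ?thesis
      by (simp add: linear_maps_def car)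
  qed
  have "vlinear (map_space scale ?D) ?T r"
    unfolding vlinear_def
    using r_T by (auto simp: map_space_def linear_maps_def subspace_of_def r_def car
        intro!: restrict_ext)
  moreover have "bij_betw r ?D (vcarrier ?T)"
  proof (rule bij_betw_imageI)
    show "inj_on r ?D"
    proof (rule inj_onI)
      fix d e assume "d \<in> ?D" "e \<in> ?D" "r d = r e"
      then show "d = e"
        using r_coset[of d] r_coset[of e] by (metis ext)
    qed
    show "r ` ?D = vcarrier ?T"
    proof (intro equalityI subsetI)
      fix f assume f: "f \<in> vcarrier ?T"
      then have ext: "f \<in> extensional (range (coset U))"
        and lin: "vlinear (quotient_space scale U) (subspace_of scale W) f"
        by (simp_all add: linear_maps_def car)
      \<comment> \<open>The preimage of \<open>f\<close> under \<open>r\<close> is its composite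
        with the projection.\<close>
      define d where "d x = f (coset U x)" for x
      have add: "d (x + y) = d x + d y" and scl: "d (scale c x) = scale c (d x)"
        and ran: "d x \<in> W" for x y c
        using lin unfolding vlinear_def car d_def
        by (auto simp: quotient_space_vadd[OF U, symmetric] quotient_space_vscale[OF U, symmetric]
            subspace_of_def)
      have linear: "Vector_Spaces.linear scale scale d"
        unfolding Vector_Spaces.linear_iff using vector_space_axioms add scl by blast
      have "d u = 0" if "u \<in> U" for u
      proof -
        have "coset U u = coset U 0"
          using that by (simp add: coset_eq_iff[OF U])
        then have "d u = d 0"
          by (simp add: d_def)
        then show ?thesis
          by (simp add: P.linear_0[OF linear])
      qed
      then have dD: "d \<in> ?D"
        using linear ran by auto
      have "r d = f"
      proof (rule extensionalityI[of _ "range (coset U)"])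
        show "r d \<in> extensional (range (coset U))"
          by (simp add: r_def)
        show "r d A = f A" if "A \<in> range (coset U)" for A
          using that r_coset[OF dD] by (auto simp: d_def)
      qed (rule ext)
      then show "f \<in> r ` ?D"
        using dD by blast
    qed (use r_T in blast)
  qed
  ultimately show ?thesis
    unfolding visomorphic_def by (auto simp: map_space_def)
qed

text \<open>Going from \<open>D\<close> to \<open>T\<close> and back to \<open>C\<close> is an
  injective linear map into a subspace of \<open>D\<close>, and \<open>D\<close> is
  finite-dimensional, so the dimension count applies.\<close>

lemma (in finite_dimensional_vector_space) map_space_eq_if_visomorphic:
  fixes C D :: "('b \<Rightarrow> 'b) set" and T :: "('a, 'w) vspace"
  assumes C: "module.subspace (\<lambda>c f x. scale c (f x)) C"
    and D: "module.subspace (\<lambda>c f x. scale c (f x)) D"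
    and CD: "C \<subseteq> D" and lin: "D \<subseteq> {d. Vector_Spaces.linear scale scale d}"
    and isoC: "visomorphic (map_space scale C) T" and isoD: "visomorphic (map_space scale D) T"
  shows "C = D"
proof -
  interpret fn: vector_space "\<lambda>c (f :: 'b \<Rightarrow> 'b) x. scale c (f x)"
    by (rule vector_space_fun)
  obtain F where F: "finite F" "{d. Vector_Spaces.linear scale scale d} \<subseteq> fn.span F"
    using linear_maps_finite_span .
  obtain f where f: "vlinear (map_space scale C) T f" "bij_betw f C (vcarrier T)"
    using isoC by (auto simp: visomorphic_def map_space_def)
  obtain r where r: "vlinear (map_space scale D) T r" "bij_betw r D (vcarrier T)"
    using isoD by (auto simp: visomorphic_def map_space_def)
  have f_add: "f (d + e) = vadd T (f d) (f e)" if "d \<in> C" "e \<in> C" for d e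
    using f(1) that by (auto simp: vlinear_def map_space_def plus_fun_def)
  have f_scl: "f (\<lambda>x. scale c (d x)) = vscale T c (f d)" if "d \<in> C" for d c
    using f(1) that by (auto simp: vlinear_def map_space_def)
  have r_add: "r (d + e) = vadd T (r d) (r e)" if "d \<in> D" "e \<in> D" for d e
    using r(1) that by (auto simp: vlinear_def map_space_def plus_fun_def)
  have r_scl: "r (\<lambda>x. scale c (d x)) = vscale T c (r d)" if "d \<in> D" for d c
    using r(1) that by (auto simp: vlinear_def map_space_def)
  define k where "k d = inv_into C f (r d)" for d
  have rT: "r d \<in> f ` C" if "d \<in> D" for d
    using that f(2) r(2) by (auto simp: bij_betw_def)
  have k: "k d \<in> C" "f (k d) = r d" if "d \<in> D" for d
    using rT[OF that] unfolding k_def by (rule inv_into_into, rule f_inv_into_f)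
  \<comment> \<open>Injectivity of \<open>f\<close> on \<open>C\<close> characterises
    \<open>k d\<close> by its image. Linearity of \<open>k\<close> then follows by comparing images
    in \<open>T\<close>.\<close>
  have k_eq: "k d = e" if "d \<in> D" "e \<in> C" "f e = r d" for d e
    using k[OF that(1)] that f(2) by (metis bij_betw_def inj_onD)
  show ?thesis
  proof (rule fn.subspace_eq_if_injective[OF C D CD F(1)])
    show "D \<subseteq> fn.span F"
      using lin F(2) by blast
    show "k (d + e) = k d + k e" if "d \<in> D" "e \<in> D" for d e
      using that k by (intro k_eq) (simp_all add: f_add r_add fn.subspace_add[OF C] fn.subspace_add[OF D])
    show "k (\<lambda>x. scale c (d x)) = (\<lambda>x. scale c (k d x))" if "d \<in> D" for c d
      using that k by (intro k_eq) (auto simp: f_scl r_scl fn.subspace_scale[OF C] fn.subspace_scale[OF D])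
    show "inj_on k D"
    proof (rule inj_onI)
      fix d e assume "d \<in> D" "e \<in> D" "k d = k e"
      then show "d = e"
        using k(2) r(2) by (metis bij_betw_def inj_onD)
    qed
    show "k ` D \<subseteq> C"
      using k(1) by blast
  qed
qed

text \<open>The map sends \<open>x\<close> to \<open>f(x) z\<close>, where the functional
  \<open>f\<close> vanishes on \<open>U\<close> and takes the value 1 at \<open>v\<close>. It is
  built by extending a basis of \<open>U\<close> by \<open>v\<close>.\<close>

lemma (in vector_space) linear_vanishing_on_subspace:
  assumes U: "subspace U" and v: "v \<notin> U"
  obtains d where "Vector_Spaces.linear scale scale d" "\<And>u. u \<in> U \<Longrightarrow> d u = 0"
    "d v = z" "range d \<subseteq> span {z}"
proof -
  interpret P: vector_space_pair scale scale ..
  obtain B where B: "B \<subseteq> U" "independent B" "U \<subseteq> span B"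
    using maximal_independent_subset .
  have "v \<notin> span B"
    using v span_minimal[OF B(1) U] by blast
  then have ind: "independent (insert v B)"
    using B(2) by (rule independent_insertI)
  let ?g = "\<lambda>b. if b = v then z else 0"
  define d where "d = P.construct (insert v B) ?g"
  have lin: "Vector_Spaces.linear scale scale d"
    unfolding d_def by (rule P.linear_construct[OF ind])
  have d: "d b = ?g b" if "b \<in> insert v B" for b
    unfolding d_def by (rule P.construct_basis[OF ind that])
  have "d u = 0" if "u \<in> U" for u
    proof (rule P.linear_eq_0_on_span[OF lin])
    show "d b = 0" if "b \<in> B" for b
      using d[of b] that B(1) v by auto
    show "u \<in> span B"
      using that B(3) by blast
  qed
  moreover have "range d \<subseteq> span {z}"
  proof -
    have "span (?g ` insert v B) \<subseteq> span {z}"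
      by (rule span_minimal) (auto simp: span_zero span_base)
    then show ?thesis
      using P.construct_in_span[OF ind, of ?g] by (auto simp: d_def)
  qed
  ultimately show ?thesis
    using that lin d by simp
qed

section \<open>Lie-central and almost inner Lie-derivations\<close>

context leibniz_algebra
begin

lemma br_add_left: "br (x + y) z = br x z + br y z"
  and br_add_right: "br z (x + y) = br z x + br z y"
  and br_scale_left: "br (scale c x) z = scale c (br x z)"
  and br_scale_right: "br z (scale c x) = scale c (br z x)"
  using linear_left[of z] linear_right[of z] by (auto simp: Vector_Spaces.linear_iff)

lemma br_zero_left: "br 0 x = 0" and br_zero_right: "br x 0 = 0"
  using br_add_left[of 0 0 x] br_add_right[of x 0 0] by simp_all

lemma lie_br_add_right: "lie_br br x (y + z) = lie_br br x y + lie_br br x z"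
  by (simp add: lie_br_def br_add_left br_add_right)

lemma lie_br_scale_right: "lie_br br x (scale c y) = scale c (lie_br br x y)"
  by (simp add: lie_br_def br_scale_left br_scale_right scale_right_distrib)

lemma lie_br_zero_right: "lie_br br x 0 = 0"
  by (simp add: lie_br_def br_zero_left br_zero_right)

lemma lie_br_commute: "lie_br br x y = lie_br br y x"
  by (simp add: lie_br_def add.commute)

lemma subspace_centre: "subspace (centre br)"
  by (rule subspaceI)
    (simp_all add: centre_def br_zero_left br_zero_right br_add_left br_add_right
      br_scale_left br_scale_right)

lemma subspace_Lie_centre: "subspace (Lie_centre br)"
  by (rule subspaceI)
    (simp_all add: Lie_centre_def lie_br_zero_right lie_br_add_right lie_br_scale_right)

lemma centre_subset_Lie_centre: "centre br \<subseteq> Lie_centre br"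
  by (auto simp: centre_def Lie_centre_def lie_br_def)

lemma subspace_gamma2_Lie: "subspace (gamma2_Lie scale br)"
  unfolding gamma2_Lie_def by (rule subspace_Inter) (simp add: two_sided_ideal_def)

lemma lie_br_in_gamma2_Lie: "lie_br br x y \<in> gamma2_Lie scale br"
  unfolding gamma2_Lie_def by blast

text \<open>Any subspace of the centre is a two-sided ideal, because all brackets with it are 0.
  Hence \<open>S \<inter> centre br\<close> is one of the ideals intersected in
  \<open>gamma2_Lie\<close>, and closure of \<open>S\<close> under the bracket is not an
  issue.\<close>

lemma gamma2_Lie_minimal:
  assumes "gamma2_Lie scale br \<subseteq> centre br" "subspace S" "\<And>x y. lie_br br x y \<in> S"
  shows "gamma2_Lie scale br \<subseteq> S"
proof -
  let ?I = "S \<inter> centre br"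
  have "two_sided_ideal scale br ?I"
    using subspace_inter[OF assms(2) subspace_centre] subspace_0
    by (auto simp: two_sided_ideal_def centre_def)
  moreover have "{lie_br br x y |x y. True} \<subseteq> ?I"
    using assms lie_br_in_gamma2_Lie by blast
  ultimately show ?thesis
    unfolding gamma2_Lie_def by blast
qed

text \<open>For fixed \<open>x\<close> the set of all \<open>lie_br br x y\<close> is a subspace, by
  linearity in \<open>y\<close>; so witnesses for \<open>d\<close> and \<open>e\<close> at
  \<open>x\<close> can be added and scaled.\<close>

lemma subspace_Der_c_Lie: "module.subspace (\<lambda>c f x. scale c (f x)) (Der_c_Lie scale br)"
proof -
  interpret fn: vector_space "\<lambda>c (f :: 'g \<Rightarrow> 'g) x. scale c (f x)"
    by (rule vector_space_fun)
  have add_left: "lie_br br (x + y) z = lie_br br x z + lie_br br y z"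
    and scale_left: "lie_br br (scale c x) z = scale c (lie_br br x z)"
    and zero_left: "lie_br br 0 z = 0" for x y z c
    using lie_br_add_right lie_br_scale_right lie_br_zero_right by (simp_all add: lie_br_commute[of _ z])
  show ?thesis
  proof (rule fn.subspaceI)
    show "0 \<in> Der_c_Lie scale br"
      using vector_space_axioms
      by (auto simp: Der_c_Lie_def Lie_derivation_def Vector_Spaces.linear_iff zero_left lie_br_zero_right
          intro!: exI[of _ 0])
  next
    fix d e assume de: "d \<in> Der_c_Lie scale br" "e \<in> Der_c_Lie scale br"
    have "\<exists>y. (d + e) x = lie_br br x y" for x
    proof -
      obtain y z where "d x = lie_br br x y" "e x = lie_br br x z"
        using de unfolding Der_c_Lie_def by blast
      then show ?thesis
        by (auto simp: lie_br_add_right intro!: exI[of _ "y + z"])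
    qed
    moreover have "Lie_derivation scale br (d + e)"
      using de by (auto simp: Der_c_Lie_def Lie_derivation_def Vector_Spaces.linear_iff add_left
          lie_br_add_right scale_right_distrib ac_simps)
    ultimately show "d + e \<in> Der_c_Lie scale br"
      by (auto simp: Der_c_Lie_def)
  next
    fix c d assume d: "d \<in> Der_c_Lie scale br"
    have "\<exists>y. scale c (d x) = lie_br br x y" for x
    proof -
      obtain y where "d x = lie_br br x y"
        using d unfolding Der_c_Lie_def by blast
      then show ?thesis
        by (auto simp: lie_br_scale_right intro!: exI[of _ "scale c y"])
    qed
    moreover have "Lie_derivation scale br (\<lambda>x. scale c (d x))"
      using d by (auto simp: Der_c_Lie_def Lie_derivation_def Vector_Spaces.linear_iff scale_left
          lie_br_scale_right scale_right_distrib mult.commute)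
    ultimately show "(\<lambda>x. scale c (d x)) \<in> Der_c_Lie scale br"
      by (auto simp: Der_c_Lie_def)
  qed
qed

lemma Der_c_Lie_range: "d \<in> Der_c_Lie scale br \<Longrightarrow> range d \<subseteq> gamma2_Lie scale br"
  using lie_br_in_gamma2_Lie by (auto simp: Der_c_Lie_def) (metis (lifting))

lemma Der_c_Lie_subset_Der_z_Lie:
  assumes "gamma2_Lie scale br \<subseteq> centre br"
  shows "Der_c_Lie scale br \<subseteq> Der_z_Lie scale br"
proof
  fix d assume d: "d \<in> Der_c_Lie scale br"
  then have "range d \<subseteq> Lie_centre br"
    using Der_c_Lie_range assms centre_subset_Lie_centre by blast
  then show "d \<in> Der_z_Lie scale br"
    using d by (simp add: Der_z_Lie_def Der_c_Lie_def)
qed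

text \<open>With values in the Lie-centre, both terms on the right of the derivation identity
  vanish, so the identity says exactly that \<open>d\<close> kills every Lie bracket.\<close>

lemma Der_z_Lie_eq:
  assumes "gamma2_Lie scale br \<subseteq> centre br"
  shows "Der_z_Lie scale br = {d. Vector_Spaces.linear scale scale d \<and>
    (\<forall>u\<in>gamma2_Lie scale br. d u = 0) \<and> range d \<subseteq> Lie_centre br}"
proof (intro equalityI subsetI; unfold mem_Collect_eq)
  interpret P: vector_space_pair scale scale ..
  fix d assume "d \<in> Der_z_Lie scale br"
  then have lin: "Vector_Spaces.linear scale scale d"
    and der: "\<And>x y. d (lie_br br x y) = lie_br br (d x) y + lie_br br x (d y)"
    and ran: "range d \<subseteq> Lie_centre br"
    by (auto simp: Der_z_Lie_def Lie_derivation_def)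
  have "lie_br br x (d y) = 0" for x y
    using ran by (auto simp: Lie_centre_def)
  then have "d (lie_br br x y) = 0" for x y
    by (simp add: der lie_br_commute[of "d x"])
  \<comment> \<open>The kernel is known to be a subspace but not an ideal, hence the appeal to
    minimality among subspaces.\<close>
  then have "gamma2_Lie scale br \<subseteq> {x. d x = 0}"
    using gamma2_Lie_minimal[OF assms P.linear_subspace_kernel[OF lin]] by auto
  then show "Vector_Spaces.linear scale scale d \<and>
      (\<forall>u\<in>gamma2_Lie scale br. d u = 0) \<and> range d \<subseteq> Lie_centre br"
    using lin ran by blast
next
  fix d assume d: "Vector_Spaces.linear scale scale d \<and>
    (\<forall>u\<in>gamma2_Lie scale br. d u = 0) \<and> range d \<subseteq> Lie_centre br"
  then have "lie_br br x (d y) = 0" for x y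
    by (auto simp: Lie_centre_def)
  then have "lie_br br (d x) y + lie_br br x (d y) = 0" for x y
    by (simp add: lie_br_commute[of "d x"])
  then show "d \<in> Der_z_Lie scale br"
    using d lie_br_in_gamma2_Lie by (simp add: Der_z_Lie_def Lie_derivation_def)
qed

lemma subspace_Der_z_Lie:
  assumes "gamma2_Lie scale br \<subseteq> centre br"
  shows "module.subspace (\<lambda>c f x. scale c (f x)) (Der_z_Lie scale br)"
proof -
  interpret fn: vector_space "\<lambda>c (f :: 'g \<Rightarrow> 'g) x. scale c (f x)"
    by (rule vector_space_fun)
  show ?thesis
    unfolding Der_z_Lie_eq[OF assms]
    using subspace_Lie_centre vector_space_axioms
    by (intro fn.subspaceI)
      (auto simp: Vector_Spaces.linear_iff subspace_0 subspace_add subspace_scale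
        scale_right_distrib image_subset_iff ac_simps)
qed

text \<open>The equality makes the subspace killed by the derivations the one divided out, and the
  space of their values the target \<open>gamma2_Lie\<close>.\<close>

lemma visomorphic_Der_z_Lie:
  assumes "gamma2_Lie scale br \<subseteq> centre br" and "Lie_centre br = gamma2_Lie scale br"
  shows "visomorphic (map_space scale (Der_z_Lie scale br))
    (linear_maps (quotient_space scale (Lie_centre br))
                 (subspace_of scale (gamma2_Lie scale br)))"
  unfolding Der_z_Lie_eq[OF assms(1)] assms(2)
  by (rule map_space_iso_linear_maps[OF subspace_gamma2_Lie])

text \<open>Each \<open>z\<close> in the Lie-centre is a value of some Lie-central derivation; by
  assumption that derivation is almost inner, so its values lie in
  \<open>gamma2_Lie\<close>.\<close>

lemma Lie_centre_subset_gamma2_Lie: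
  assumes "non_abelian br" and "gamma2_Lie scale br \<subseteq> centre br"
    and "Der_z_Lie scale br \<subseteq> Der_c_Lie scale br"
  shows "Lie_centre br \<subseteq> gamma2_Lie scale br"
proof
  fix z assume z: "z \<in> Lie_centre br"
  \<comment> \<open>If \<open>gamma2_Lie\<close> were everything, so would be the centre, and the
    bracket would vanish identically.\<close>
  obtain v where v: "v \<notin> gamma2_Lie scale br"
    using assms(1,2) by (auto simp: non_abelian_def centre_def)
  obtain d where d: "Vector_Spaces.linear scale scale d"
    "\<And>u. u \<in> gamma2_Lie scale br \<Longrightarrow> d u = 0" "d v = z" "range d \<subseteq> span {z}"
    using linear_vanishing_on_subspace[OF subspace_gamma2_Lie v, of z] by blast
  have "span {z} \<subseteq> Lie_centre br"
    using z by (intro span_minimal subspace_Lie_centre) simp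
  then have "d \<in> Der_z_Lie scale br"
    using d by (auto simp: Der_z_Lie_eq[OF assms(2)])
  then show "z \<in> gamma2_Lie scale br"
    using assms(3) Der_c_Lie_range d(3) by blast
qed

end

theorem theorem5p4:
  fixes scale :: "'k::field \<Rightarrow> 'g::ab_group_add \<Rightarrow> 'g"
    and br :: "'g \<Rightarrow> 'g \<Rightarrow> 'g"
  assumes "(2::'k) \<noteq> 0"
    and "leibniz_algebra scale br"
    and "\<exists>Basis. finite_dimensional_vector_space scale Basis"
    and "non_abelian br"
    and "gamma2_Lie scale br \<subseteq> centre br"
  shows "Der_c_Lie scale br = Der_z_Lie scale br \<longleftrightarrow>
    Lie_centre br = gamma2_Lie scale br \<and>
    visomorphic (map_space scale (Der_c_Lie scale br))
      (linear_maps (quotient_space scale (Lie_centre br))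
                   (subspace_of scale (gamma2_Lie scale br)))"
    (is "_ \<longleftrightarrow> _ \<and> ?iso")
proof -
  interpret leibniz_algebra scale br
    by (rule assms(2))
  obtain Basis where Basis: "finite_dimensional_vector_space scale Basis"
    using assms(3) by blast
  show ?thesis
  proof
    assume eq: "Der_c_Lie scale br = Der_z_Lie scale br"
    then have "Lie_centre br = gamma2_Lie scale br"
      using Lie_centre_subset_gamma2_Lie[OF assms(4,5)] assms(5) centre_subset_Lie_centre by blast
    then show "Lie_centre br = gamma2_Lie scale br \<and> ?iso"
      using visomorphic_Der_z_Lie[OF assms(5)] eq by simp
  next
    assume R: "Lie_centre br = gamma2_Lie scale br \<and> ?iso"
    show "Der_c_Lie scale br = Der_z_Lie scale br"
    \<comment> \<open>Both spaces of derivations are isomorphic to the same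
      \<open>linear_maps\<close> space: the almost inner one by assumption, the Lie-central one by
      \<open>visomorphic_Der_z_Lie\<close>.\<close>
    proof (rule finite_dimensional_vector_space.map_space_eq_if_visomorphic[OF Basis])
      show "Der_z_Lie scale br \<subseteq> {d. Vector_Spaces.linear scale scale d}"
        by (auto simp: Der_z_Lie_eq[OF assms(5)])
    qed (use R subspace_Der_c_Lie subspace_Der_z_Lie[OF assms(5)] Der_c_Lie_subset_Der_z_Lie[OF assms(5)]
        visomorphic_Der_z_Lie[OF assms(5)] in blast)+
  qed
qed

end
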